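(* Let $\mathcal{H}$ be a separable complex Hilbert space, $m\in\mathbb{N}\setminus\{0\}$, $I=\{0,\ldots,m-1\}$, $A\in L(\mathcal{H})$ and $f_i\in\mathcal{H}$, $i\in I$. Then the following statements are equivalent. (i) $(A^nf_i)_{n\in\mathbb{N},\,i\in I}$ is a Riesz basis of $\mathcal{H}$. (ii) There exists a boundedly invertible operator $V\in L(\ell^2(\mathbb{N}),\mathcal{H})$ such that $$A=VR^mV^{-1}\qquad\text{and}\qquad f_i=Ve_i,\ i\in I.$$
   Context: $\mathbb{N}=\{0,1,2,\dots\}$. $L(\mathcal{K},\mathcal{H})$ denotes the bounded linear operators from $\mathcal{K}$ to $\mathcal{H}$, and $L(\mathcal{H})=L(\mathcal{H},\mathcal{H})$. $R\in L(\ell^2(\mathbb{N}))$ is the right-shift: $(Rf)(0)=0$ and $(Rf)(j)=f(j-1)$ for $j\ge1$. $e_k$ is the $k$-th standard basis vector of $\ell^2(\mathbb{N})$, $k\in\mathbb{N}$. *)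

theory Defs
  imports "HOL-Analysis.Analysis"
begin

section \<open>Complex Hilbert spaces\<close>

class complex_vector = real_vector +
  fixes scaleC :: "complex \<Rightarrow> 'a \<Rightarrow> 'a" (infixr \<open>*\<^sub>C\<close> 75)
  assumes scaleC_add_right: "a *\<^sub>C (x + y) = a *\<^sub>C x + a *\<^sub>C y"
    and scaleC_add_left: "(a + b) *\<^sub>C x = a *\<^sub>C x + b *\<^sub>C x"
    and scaleC_scaleC: "a *\<^sub>C (b *\<^sub>C x) = (a * b) *\<^sub>C x"
    and scaleR_scaleC: "r *\<^sub>R x = complex_of_real r *\<^sub>C x"

lemma scaleC_one: "1 *\<^sub>C x = (x :: 'a::complex_vector)"
  using scaleR_scaleC[of 1 x] by simp

global_interpretation complex_vector: vector_space "scaleC :: complex \<Rightarrow> 'a \<Rightarrow> 'a::complex_vector"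
  defines cspan = complex_vector.span
  by unfold_locales (auto simp: scaleC_add_right scaleC_add_left scaleC_scaleC scaleC_one)

text \<open>The inner product is linear in its first argument.\<close>

class complex_inner = complex_vector + real_normed_vector +
  fixes cinner :: "'a \<Rightarrow> 'a \<Rightarrow> complex"
  assumes cinner_commute: "cinner x y = cnj (cinner y x)"
    and cinner_add_left: "cinner (x + y) z = cinner x z + cinner y z"
    and cinner_scaleC_left: "cinner (a *\<^sub>C x) y = a * cinner x y"
    and cinner_ge_zero: "0 \<le> Re (cinner x x)"
    and cinner_eq_zero_iff: "cinner x x = 0 \<longleftrightarrow> x = 0"
    and norm_eq_sqrt_cinner: "norm x = sqrt (Re (cinner x x))"

class complex_hilbert = complex_inner + complete_space

definition bounded_clinear :: "('a::complex_inner \<Rightarrow> 'b::complex_inner) \<Rightarrow> bool" where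
  "bounded_clinear T \<longleftrightarrow> bounded_linear T \<and> (\<forall>c x. T (c *\<^sub>C x) = c *\<^sub>C T x)"

definition boundedly_invertible :: "('a::complex_inner \<Rightarrow> 'b::complex_inner) \<Rightarrow> bool" where
  "boundedly_invertible T \<longleftrightarrow> bounded_clinear T \<and> bij T \<and> bounded_clinear (inv T)"

text \<open>
  A Riesz basis is a complete Riesz sequence. As a family indexed by \<open>J\<close> (rather than a set of
  vectors) it may not repeat a vector: the lower bound excludes this.
\<close>

definition riesz_basis :: "'i set \<Rightarrow> ('i \<Rightarrow> 'a::complex_hilbert) \<Rightarrow> bool" where
  "riesz_basis J g \<longleftrightarrow>
     closure (cspan (g ` J)) = UNIV \<and>
     (\<exists>\<alpha>>0. \<exists>\<beta>>0. \<forall>F c. finite F \<longrightarrow> F \<subseteq> J \<longrightarrow>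
        \<alpha> * (\<Sum>j\<in>F. (cmod (c j))\<^sup>2) \<le> (norm (\<Sum>j\<in>F. c j *\<^sub>C g j))\<^sup>2 \<and>
        (norm (\<Sum>j\<in>F. c j *\<^sub>C g j))\<^sup>2 \<le> \<beta> * (\<Sum>j\<in>F. (cmod (c j))\<^sup>2))"


section \<open>The space of square-summable sequences\<close>

typedef ell2 = "{f :: nat \<Rightarrow> complex. summable (\<lambda>n. (cmod (f n))\<^sup>2)}"
  morphisms ell2_nth Abs_ell2
  by (rule exI[of _ "\<lambda>_. 0"]) simp

setup_lifting type_definition_ell2

lemma summable_ell2: "summable (\<lambda>n. (cmod (ell2_nth f n))\<^sup>2)"
  using ell2_nth[of f] by simp

lemma ell2_eqI: "(\<And>n. ell2_nth f n = ell2_nth g n) \<Longrightarrow> f = g"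
  by (metis ell2_nth_inject ext)

lemma summable_sq_add:
  fixes f g :: "nat \<Rightarrow> complex"
  assumes "summable (\<lambda>n. (cmod (f n))\<^sup>2)" "summable (\<lambda>n. (cmod (g n))\<^sup>2)"
  shows "summable (\<lambda>n. (cmod (f n + g n))\<^sup>2)"
proof (rule summable_comparison_test_ev)
  show "summable (\<lambda>n. 2 * (cmod (f n))\<^sup>2 + 2 * (cmod (g n))\<^sup>2)"
    using assms by (intro summable_add summable_mult)
  have "(cmod (f n + g n))\<^sup>2 \<le> 2 * (cmod (f n))\<^sup>2 + 2 * (cmod (g n))\<^sup>2" for n
  proof -
    have "(cmod (f n + g n))\<^sup>2 \<le> (cmod (f n) + cmod (g n))\<^sup>2"
      by (intro power_mono norm_triangle_ineq) simp
    also have "\<dots> \<le> 2 * (cmod (f n))\<^sup>2 + 2 * (cmod (g n))\<^sup>2"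
      using sum_squares_bound[of "cmod (f n)" "cmod (g n)"] by (simp add: power2_sum)
    finally show ?thesis .
  qed
  then show "\<forall>\<^sub>F n in sequentially. norm ((cmod (f n + g n))\<^sup>2) \<le> 2 * (cmod (f n))\<^sup>2 + 2 * (cmod (g n))\<^sup>2"
    by simp
qed

lemma summable_sq_scale:
  fixes f :: "nat \<Rightarrow> complex"
  shows "summable (\<lambda>n. (cmod (f n))\<^sup>2) \<Longrightarrow> summable (\<lambda>n. (cmod (c * f n))\<^sup>2)"
  by (simp add: norm_mult power_mult_distrib summable_mult)

instantiation ell2 :: complex_vector
begin

lift_definition zero_ell2 :: ell2 is "\<lambda>_. 0" by simp
lift_definition plus_ell2 :: "ell2 \<Rightarrow> ell2 \<Rightarrow> ell2" is "\<lambda>f g n. f n + g n"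
  by (rule summable_sq_add)
lift_definition uminus_ell2 :: "ell2 \<Rightarrow> ell2" is "\<lambda>f n. - f n" by simp
lift_definition scaleC_ell2 :: "complex \<Rightarrow> ell2 \<Rightarrow> ell2" is "\<lambda>c f n. c * f n"
  by (rule summable_sq_scale)
definition "f - g = f + - g" for f g :: ell2
definition "r *\<^sub>R f = complex_of_real r *\<^sub>C f" for f :: ell2

instance
  by standard
    (unfold minus_ell2_def scaleR_ell2_def, (transfer, auto simp: algebra_simps)+)

end

lemma ell2_nth_simps [simp]:
  "ell2_nth 0 n = 0"
  "ell2_nth (f + g) n = ell2_nth f n + ell2_nth g n"
  "ell2_nth (- f) n = - ell2_nth f n"
  "ell2_nth (f - g) n = ell2_nth f n - ell2_nth g n"
  "ell2_nth (c *\<^sub>C f) n = c * ell2_nth f n"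
  "ell2_nth (r *\<^sub>R f) n = complex_of_real r * ell2_nth f n"
  by (simp_all add: minus_ell2_def scaleR_ell2_def zero_ell2.rep_eq plus_ell2.rep_eq
      uminus_ell2.rep_eq scaleC_ell2.rep_eq del: add_uminus_conv_diff)

lemma summable_cinner_ell2: "summable (\<lambda>n. ell2_nth f n * cnj (ell2_nth g n))"
proof (rule summable_comparison_test_ev)
  show "summable (\<lambda>n. (cmod (ell2_nth f n))\<^sup>2 + (cmod (ell2_nth g n))\<^sup>2)"
    by (intro summable_add summable_ell2)
  have "cmod (ell2_nth f n) * cmod (ell2_nth g n) \<le> (cmod (ell2_nth f n))\<^sup>2 + (cmod (ell2_nth g n))\<^sup>2" for n
    using sum_squares_bound[of "cmod (ell2_nth f n)" "cmod (ell2_nth g n)"]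
      mult_nonneg_nonneg[OF norm_ge_zero[of "ell2_nth f n"] norm_ge_zero[of "ell2_nth g n"]]
    by linarith
  then show "\<forall>\<^sub>F n in sequentially. norm (ell2_nth f n * cnj (ell2_nth g n))
      \<le> (cmod (ell2_nth f n))\<^sup>2 + (cmod (ell2_nth g n))\<^sup>2"
    by (simp add: norm_mult)
qed

instantiation ell2 :: complex_inner
begin

definition "cinner f g = (\<Sum>n. ell2_nth f n * cnj (ell2_nth g n))" for f g :: ell2
definition "norm f = sqrt (\<Sum>n. (cmod (ell2_nth f n))\<^sup>2)" for f :: ell2
definition "sgn f = f /\<^sub>R norm f" for f :: ell2
definition "dist f g = norm (f - g)" for f g :: ell2
definition
  "(uniformity :: (ell2 \<times> ell2) filter) = (INF e\<in>{0<..}. principal {(f, g). dist f g < e})"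
definition
  "open U \<longleftrightarrow> (\<forall>f\<in>U. \<forall>\<^sub>F (f', g) in uniformity. f' = f \<longrightarrow> g \<in> U)" for U :: "ell2 set"

instance
proof
  fix f g h :: ell2 and c :: complex and r :: real and U :: "ell2 set"
  have inner_self: "cinner f f = complex_of_real (\<Sum>n. (cmod (ell2_nth f n))\<^sup>2)" for f :: ell2
    unfolding cinner_ell2_def complex_norm_square[symmetric]
    by (subst suminf_of_real[OF summable_ell2]) simp
  have zero_iff: "(\<Sum>n. (cmod (ell2_nth f n))\<^sup>2) = 0 \<longleftrightarrow> f = 0" for f :: ell2
    by (subst suminf_eq_zero_iff[OF summable_ell2]) (auto intro: ell2_eqI)
  have partial: "L2_set (\<lambda>n. cmod (ell2_nth f n)) {..<N} \<le> norm f" for N and f :: ell2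
    unfolding L2_set_def norm_ell2_def
    by (intro real_sqrt_le_mono sum_le_suminf summable_ell2) auto
  have norm_ge: "0 \<le> norm f" for f :: ell2
    unfolding norm_ell2_def by (simp add: suminf_nonneg summable_ell2)
  show "dist f g = norm (f - g)" by (rule dist_ell2_def)
  show "sgn f = f /\<^sub>R norm f" by (rule sgn_ell2_def)
  show "(uniformity :: (ell2 \<times> ell2) filter) = (INF e\<in>{0<..}. principal {(f, g). dist f g < e})"
    by (rule uniformity_ell2_def)
  show "open U = (\<forall>f\<in>U. \<forall>\<^sub>F (f', g) in uniformity. f' = f \<longrightarrow> g \<in> U)"
    by (rule open_ell2_def)
  show "norm f = 0 \<longleftrightarrow> f = 0"
    by (simp add: norm_ell2_def zero_iff)
  show "norm (f + g) \<le> norm f + norm g"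
  proof -
    have "(\<Sum>n<N. (cmod (ell2_nth (f + g) n))\<^sup>2) \<le> (norm f + norm g)\<^sup>2" for N
    proof -
      have "L2_set (\<lambda>n. cmod (ell2_nth (f + g) n)) {..<N}
          \<le> L2_set (\<lambda>n. cmod (ell2_nth f n) + cmod (ell2_nth g n)) {..<N}"
        by (rule L2_set_mono) (auto intro: norm_triangle_ineq)
      also have "\<dots> \<le> L2_set (\<lambda>n. cmod (ell2_nth f n)) {..<N} + L2_set (\<lambda>n. cmod (ell2_nth g n)) {..<N}"
        by (rule L2_set_triangle_ineq)
      also have "\<dots> \<le> norm f + norm g"
        by (intro add_mono partial)
      finally show ?thesis
        unfolding L2_set_def by (rule sqrt_le_D)
    qed
    then have "(\<Sum>n. (cmod (ell2_nth (f + g) n))\<^sup>2) \<le> (norm f + norm g)\<^sup>2"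
      by (intro suminf_le_const summable_ell2)
    then show ?thesis
      unfolding norm_ell2_def[of "f + g"] by (intro real_le_lsqrt add_nonneg_nonneg norm_ge)
  qed
  show "norm (r *\<^sub>R f) = \<bar>r\<bar> * norm f"
    by (simp add: norm_ell2_def norm_mult power_mult_distrib suminf_mult[OF summable_ell2] real_sqrt_mult)
  show "cinner f g = cnj (cinner g f)"
    unfolding cinner_ell2_def
    using sums_cnj[THEN iffD2, OF summable_sums[OF summable_cinner_ell2[of g f]]]
    by (simp add: sums_iff mult.commute)
  show "cinner (f + g) h = cinner f h + cinner g h"
    unfolding cinner_ell2_def
    by (subst suminf_add[OF summable_cinner_ell2 summable_cinner_ell2]) (simp add: algebra_simps)
  show "cinner (c *\<^sub>C f) g = c * cinner f g"
    unfolding cinner_ell2_def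
    by (subst suminf_mult[OF summable_cinner_ell2, symmetric]) (simp add: algebra_simps)
  show "0 \<le> Re (cinner f f)"
    unfolding inner_self by (simp add: suminf_nonneg summable_ell2)
  show "cinner f f = 0 \<longleftrightarrow> f = 0"
    unfolding inner_self of_real_eq_0_iff by (rule zero_iff)
  show "norm f = sqrt (Re (cinner f f))"
    unfolding inner_self norm_ell2_def by (simp only: Re_complex_of_real)
qed

end

lemma norm_ell2_nth_le: "cmod (ell2_nth f n) \<le> norm f"
proof -
  have "(\<Sum>i\<in>{n}. (cmod (ell2_nth f i))\<^sup>2) \<le> (\<Sum>i. (cmod (ell2_nth f i))\<^sup>2)"
    by (intro sum_le_suminf summable_ell2) auto
  then show ?thesis
    unfolding norm_ell2_def by (simp add: real_le_rsqrt)
qed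

instance ell2 :: complex_hilbert
proof
  fix X :: "nat \<Rightarrow> ell2"
  assume X: "Cauchy X"
  have "Cauchy (\<lambda>i. ell2_nth (X i) k)" for k
  proof (rule metric_CauchyI)
    fix e :: real
    assume "e > 0"
    then obtain M where M: "\<And>i j. i \<ge> M \<Longrightarrow> j \<ge> M \<Longrightarrow> dist (X i) (X j) < e"
      using metric_CauchyD[OF X] by blast
    have "dist (ell2_nth (X i) k) (ell2_nth (X j) k) < e" if "i \<ge> M" "j \<ge> M" for i j
      using M[OF that] norm_ell2_nth_le[of "X i - X j" k] by (simp add: dist_norm)
    then show "\<exists>M. \<forall>i\<ge>M. \<forall>j\<ge>M. dist (ell2_nth (X i) k) (ell2_nth (X j) k) < e"
      by blast
  qed
  then have "\<exists>l. \<forall>k. (\<lambda>i. ell2_nth (X i) k) \<longlonglongrightarrow> l k"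
    by (meson Cauchy_convergent convergent_def choice)
  then obtain l where l: "\<And>k. (\<lambda>i. ell2_nth (X i) k) \<longlonglongrightarrow> l k"
    by blast
  have tail: "\<exists>M. \<forall>i\<ge>M. \<forall>N. (\<Sum>k<N. (cmod (ell2_nth (X i) k - l k))\<^sup>2) \<le> e\<^sup>2" if "e > 0" for e
  proof -
    obtain M where M: "\<And>i j. i \<ge> M \<Longrightarrow> j \<ge> M \<Longrightarrow> dist (X i) (X j) < e"
      using metric_CauchyD[OF X \<open>e > 0\<close>] by blast
    have "(\<Sum>k<N. (cmod (ell2_nth (X i) k - l k))\<^sup>2) \<le> e\<^sup>2" if i: "i \<ge> M" for i N
    proof (rule tendsto_upperbound)
      show "(\<lambda>j. \<Sum>k<N. (cmod (ell2_nth (X i) k - ell2_nth (X j) k))\<^sup>2)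
          \<longlonglongrightarrow> (\<Sum>k<N. (cmod (ell2_nth (X i) k - l k))\<^sup>2)"
        by (intro tendsto_intros l)
      have "(\<Sum>k<N. (cmod (ell2_nth (X i) k - ell2_nth (X j) k))\<^sup>2) \<le> e\<^sup>2" if j: "j \<ge> M" for j
      proof -
        have "(\<Sum>k<N. (cmod (ell2_nth (X i - X j) k))\<^sup>2) \<le> (\<Sum>k. (cmod (ell2_nth (X i - X j) k))\<^sup>2)"
          by (intro sum_le_suminf summable_ell2) auto
        also have "\<dots> = (norm (X i - X j))\<^sup>2"
          unfolding norm_ell2_def by (simp add: suminf_nonneg[OF summable_ell2] del: ell2_nth_simps)
        also have "\<dots> \<le> e\<^sup>2"
          using M[OF i j] by (intro power_mono) (auto simp: dist_norm)
        finally show ?thesis by simp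
      qed
      then show "\<forall>\<^sub>F j in sequentially. (\<Sum>k<N. (cmod (ell2_nth (X i) k - ell2_nth (X j) k))\<^sup>2) \<le> e\<^sup>2"
        by (auto simp: eventually_sequentially)
    qed simp
    then show ?thesis by blast
  qed
  have "summable (\<lambda>k. (cmod (l k))\<^sup>2)"
  proof -
    obtain M where M: "\<And>N. (\<Sum>k<N. (cmod (ell2_nth (X M) k - l k))\<^sup>2) \<le> 1"
      using tail[of 1] by auto
    have "summable (\<lambda>k. (cmod (- (ell2_nth (X M) k - l k)))\<^sup>2)"
      unfolding norm_minus_cancel using M by (intro summableI_nonneg_bounded[where x = 1]) auto
    from summable_sq_add[OF this summable_ell2[of "X M"]] show ?thesis
      by simp
  qed
  then obtain L where L: "ell2_nth L = l"
    using Abs_ell2_inverse by blast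
  have "X \<longlonglongrightarrow> L"
  proof (rule metric_LIMSEQ_I)
    fix e :: real
    assume e: "e > 0"
    then obtain M where M: "\<And>i N. i \<ge> M \<Longrightarrow> (\<Sum>k<N. (cmod (ell2_nth (X i) k - l k))\<^sup>2) \<le> (e / 2)\<^sup>2"
      using tail[of "e / 2"] by auto
    have "dist (X i) L < e" if "i \<ge> M" for i
    proof -
      have "(\<Sum>k. (cmod (ell2_nth (X i - L) k))\<^sup>2) \<le> (e / 2)\<^sup>2"
        using M[OF that] by (intro suminf_le_const summable_ell2) (simp add: L)
      then have "norm (X i - L) \<le> e / 2"
        unfolding norm_ell2_def using e by (intro real_le_lsqrt) auto
      then show ?thesis
        using e by (simp add: dist_norm)
    qed
    then show "\<exists>M. \<forall>i\<ge>M. dist (X i) L < e" by blast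
  qed
  then show "convergent X" by (rule convergentI)
qed

lift_definition ell2_basis :: "nat \<Rightarrow> ell2" is "\<lambda>k n. if n = k then 1 else 0"
  by (rule summable_finite[of "{k}" for k]) auto

lift_definition right_shift :: "ell2 \<Rightarrow> ell2" is "\<lambda>f n. if n = 0 then 0 else f (n - 1)"
  by (subst summable_Suc_iff[symmetric]) simp

end

theory Submission
  imports Defs
begin

text \<open>
  Numbering the pairs \<open>(n, i)\<close> with \<open>i < m\<close> by \<open>k = m * n + i\<close> turns the iterates into the single
  sequence \<open>h k = (A ^^ (k div m)) (f (k mod m))\<close>, and \<open>A (h k) = h (m + k)\<close>: on this sequence, \<open>A\<close>
  advances the index by \<open>m\<close>, exactly as the \<open>m\<close>-th power of the right shift does on the standard
  basis. Being a Riesz basis does not depend on the numbering (\<open>riesz_basis_reindex\<close>), so two facts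
  give the equivalence.

  First, the Riesz bases indexed by the natural numbers are exactly the images of the standard basis
  under boundedly invertible operators \<open>V\<close> (\<open>riesz_basis_iff_image_ell2_basis\<close>). The upper Riesz
  bound makes the series \<open>\<Sum>k. x k *\<^sub>C h k\<close> converge for every square-summable \<open>x\<close>, which defines a
  bounded \<open>V\<close>; the lower bound makes \<open>V\<close> bounded below, hence injective with closed range and bounded
  inverse; completeness of the family makes the range dense, hence everything.

  Second, for such a \<open>V\<close>, the equations \<open>h k = V (ell2_basis k)\<close> for all \<open>k\<close> say that \<open>V\<close> sends the
  first \<open>m\<close> basis vectors to the \<open>f i\<close> and that \<open>A \<circ> V\<close> agrees with \<open>V \<circ> (right_shift ^^ m)\<close> on the
  standard basis, hence everywhere (\<open>orbit_eq_image_ell2_basis_iff\<close>).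
\<close>

section \<open>Bounded complex-linear maps\<close>

text \<open>This makes the Cauchy criterion for series available in Hilbert spaces.\<close>

instance complex_hilbert \<subseteq> banach ..

lemma norm_scaleC: "norm (c *\<^sub>C x) = cmod c * norm (x :: 'a::complex_inner)"
proof -
  have "cinner (c *\<^sub>C x) (c *\<^sub>C x) = c * (cnj c * cinner x x)"
    by (metis cinner_commute cinner_scaleC_left complex_cnj_mult)
  also have "\<dots> = complex_of_real ((cmod c)\<^sup>2) * cinner x x"
    by (simp only: complex_norm_square mult.assoc)
  finally show ?thesis
    by (simp add: norm_eq_sqrt_cinner real_sqrt_mult del: of_real_power)
qed

lemma bounded_linear_scaleC: "bounded_linear (\<lambda>x :: 'a::complex_inner. c *\<^sub>C x)"
proof (rule bounded_linear_intro[where K = "cmod c"])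
  show "c *\<^sub>C (r *\<^sub>R x) = r *\<^sub>R (c *\<^sub>C x)" for r and x :: 'a
    by (simp add: scaleR_scaleC scaleC_scaleC mult.commute)
qed (simp_all add: scaleC_add_right norm_scaleC)

lemma bounded_clinear_scaleC: "bounded_clinear T \<Longrightarrow> T (c *\<^sub>C x) = c *\<^sub>C T x"
  by (simp add: bounded_clinear_def)

lemma bounded_clinear_compose:
  "bounded_clinear S \<Longrightarrow> bounded_clinear T \<Longrightarrow> bounded_clinear (S \<circ> T)"
  by (auto simp: bounded_clinear_def o_def intro: bounded_linear_compose)

lemma bounded_clinear_funpow:
  fixes T :: "'a::complex_inner \<Rightarrow> 'a"
  shows "bounded_clinear T \<Longrightarrow> bounded_clinear (T ^^ n)"
proof (induction n)
  case 0
  have "T ^^ 0 = (\<lambda>x. x)"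
    by auto
  then show ?case
    by (simp only: bounded_clinear_def bounded_linear_ident simp_thms)
qed (simp add: bounded_clinear_compose)

lemma bounded_clinear_sum_scaleC:
  assumes "bounded_clinear T"
  shows "T (\<Sum>j\<in>F. c j *\<^sub>C g j) = (\<Sum>j\<in>F. c j *\<^sub>C T (g j))"
proof -
  have "linear T"
    using assms by (simp add: bounded_clinear_def bounded_linear.linear)
  then show ?thesis
    by (simp add: linear_sum o_def bounded_clinear_scaleC[OF assms])
qed

lemma sums_in_closure_cspan:
  fixes g :: "nat \<Rightarrow> 'a::complex_inner"
  assumes "(\<lambda>k. c k *\<^sub>C g k) sums x"
  shows "x \<in> closure (cspan (range g))"
proof (unfold closure_sequential, intro exI conjI allI)
  show "(\<lambda>N. \<Sum>k<N. c k *\<^sub>C g k) \<longlonglongrightarrow> x"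
    using assms by (simp add: sums_def)
  show "(\<Sum>k<N. c k *\<^sub>C g k) \<in> cspan (range g)" for N
    by (intro complex_vector.span_sum complex_vector.span_scale complex_vector.span_base) simp
qed

section \<open>The standard basis of the space of square-summable sequences\<close>

lemma norm_ell2_squared: "(norm x)\<^sup>2 = (\<Sum>n. (cmod (ell2_nth x n))\<^sup>2)"
  by (simp add: norm_ell2_def suminf_nonneg summable_ell2)

lemma ell2_nth_sum: "ell2_nth (\<Sum>j\<in>F. g j) n = (\<Sum>j\<in>F. ell2_nth (g j) n)"
  by (induction F rule: infinite_finite_induct) simp_all

lemma ell2_nth_sum_basis:
  "finite F \<Longrightarrow> ell2_nth (\<Sum>j\<in>F. c j *\<^sub>C ell2_basis j) n = (if n \<in> F then c n else 0)"
  by (simp add: ell2_nth_sum ell2_basis.rep_eq if_distrib cong: if_cong)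

text \<open>The standard basis satisfies the Riesz bounds with both constants equal to 1.\<close>

lemma norm_sum_ell2_basis:
  assumes "finite F"
  shows "(norm (\<Sum>j\<in>F. c j *\<^sub>C ell2_basis j))\<^sup>2 = (\<Sum>j\<in>F. (cmod (c j))\<^sup>2)"
proof -
  have "(\<Sum>n. (cmod (if n \<in> F then c n else 0))\<^sup>2) = (\<Sum>n\<in>F. (cmod (if n \<in> F then c n else 0))\<^sup>2)"
    by (rule suminf_finite[OF assms]) simp
  then show ?thesis
    by (simp add: norm_ell2_squared ell2_nth_sum_basis[OF assms])
qed

text \<open>The squared norm of the remainder is the tail of the convergent series for the squared norm.\<close>

lemma ell2_basis_expansion: "(\<lambda>k. ell2_nth x k *\<^sub>C ell2_basis k) sums x"
proof -
  let ?S = "\<lambda>N. \<Sum>k<N. ell2_nth x k *\<^sub>C ell2_basis k"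
  have "(norm (x - ?S N))\<^sup>2 = (norm x)\<^sup>2 - (\<Sum>k<N. (cmod (ell2_nth x k))\<^sup>2)" for N
  proof -
    have eq: "(cmod (ell2_nth (x - ?S N) n))\<^sup>2
        = (cmod (ell2_nth x n))\<^sup>2 - (if n \<in> {..<N} then (cmod (ell2_nth x n))\<^sup>2 else 0)" for n
      by (simp add: ell2_nth_sum_basis)
    show ?thesis
      unfolding norm_ell2_squared eq
      by (intro sums_unique[symmetric] sums_diff summable_sums summable_ell2
          sums_If_finite_set) simp
  qed
  moreover have "(\<lambda>N. (norm x)\<^sup>2 - (\<Sum>k<N. (cmod (ell2_nth x k))\<^sup>2)) \<longlonglongrightarrow> (norm x)\<^sup>2 - (norm x)\<^sup>2"
    by (intro tendsto_intros) (simp add: norm_ell2_squared summable_LIMSEQ summable_ell2)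
  ultimately have "(\<lambda>N. (norm (x - ?S N))\<^sup>2) \<longlonglongrightarrow> 0"
    by simp
  then have "(\<lambda>N. sqrt ((norm (x - ?S N))\<^sup>2)) \<longlonglongrightarrow> sqrt 0"
    by (rule tendsto_real_sqrt)
  then have "(\<lambda>N. norm (?S N - x)) \<longlonglongrightarrow> 0"
    by (simp add: norm_minus_commute)
  then show ?thesis
    unfolding sums_def by (rule LIM_zero_cancel[OF tendsto_norm_zero_cancel])
qed

text \<open>Bounded maps act term by term on the expansion in the standard basis.\<close>

lemma bounded_clinear_eqI_ell2_basis:
  assumes "bounded_clinear S" "bounded_clinear T"
    and "\<And>k. S (ell2_basis k) = T (ell2_basis k)"
  shows "S = T"
proof
  fix x
  have "(\<lambda>k. U (ell2_nth x k *\<^sub>C ell2_basis k)) sums U x" if "bounded_clinear U" for U :: "ell2 \<Rightarrow> 'a"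
    using that ell2_basis_expansion bounded_linear.sums unfolding bounded_clinear_def by blast
  from this[OF assms(1)] this[OF assms(2)] show "S x = T x"
    by (simp add: assms bounded_clinear_scaleC sums_unique2)
qed

section \<open>The shift\<close>

lemma norm_right_shift: "norm (right_shift x) = norm x"
proof -
  have "(\<lambda>n. (cmod (ell2_nth (right_shift x) (Suc n)))\<^sup>2) sums (norm x)\<^sup>2"
    by (simp add: norm_ell2_squared right_shift.rep_eq summable_sums summable_ell2)
  then have "(\<lambda>n. (cmod (ell2_nth (right_shift x) n))\<^sup>2) sums (norm x)\<^sup>2"
    by (subst (asm) sums_Suc_iff) (simp add: right_shift.rep_eq)
  then have "(norm (right_shift x))\<^sup>2 = (norm x)\<^sup>2"
    by (simp add: norm_ell2_squared sums_iff)
  then show ?thesis by simp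
qed

lemma bounded_clinear_right_shift: "bounded_clinear right_shift"
  unfolding bounded_clinear_def
  by (auto intro!: bounded_linear_intro[where K = 1] ell2_eqI simp: norm_right_shift right_shift.rep_eq)

lemma right_shift_funpow_basis: "(right_shift ^^ n) (ell2_basis k) = ell2_basis (n + k)"
proof (induction n)
  case (Suc n)
  have "right_shift (ell2_basis (n + k)) = ell2_basis (Suc (n + k))"
    by (rule ell2_eqI) (auto simp: right_shift.rep_eq ell2_basis.rep_eq)
  then show ?case using Suc by simp
qed simp

section \<open>Riesz bases\<close>

lemma riesz_basis_reindex_imp:
  assumes bij: "bij_betw \<phi> J K" and eq: "\<And>j. j \<in> J \<Longrightarrow> g j = h (\<phi> j)"
    and "riesz_basis K h"
  shows "riesz_basis J g"
proof -
  have img: "g ` J = h ` K"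
    using bij_betw_imp_surj_on[OF bij] eq by force
  obtain \<alpha> \<beta> where pos: "\<alpha> > 0" "\<beta> > 0" and dense: "closure (cspan (h ` K)) = UNIV"
    and bound: "\<And>F c. finite F \<Longrightarrow> F \<subseteq> K \<Longrightarrow>
        \<alpha> * (\<Sum>j\<in>F. (cmod (c j))\<^sup>2) \<le> (norm (\<Sum>j\<in>F. c j *\<^sub>C h j))\<^sup>2 \<and>
        (norm (\<Sum>j\<in>F. c j *\<^sub>C h j))\<^sup>2 \<le> \<beta> * (\<Sum>j\<in>F. (cmod (c j))\<^sup>2)"
    using assms(3) unfolding riesz_basis_def by blast
  have "\<alpha> * (\<Sum>j\<in>F. (cmod (c j))\<^sup>2) \<le> (norm (\<Sum>j\<in>F. c j *\<^sub>C g j))\<^sup>2 \<and>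
        (norm (\<Sum>j\<in>F. c j *\<^sub>C g j))\<^sup>2 \<le> \<beta> * (\<Sum>j\<in>F. (cmod (c j))\<^sup>2)"
    if F: "finite F" "F \<subseteq> J" for F c
  proof -
    let ?d = "\<lambda>k. c (inv_into J \<phi> k)"
    have inj: "inj_on \<phi> F"
      using bij F by (meson bij_betw_imp_inj_on inj_on_subset)
    have d: "?d (\<phi> j) = c j" if "j \<in> F" for j
      using that F bij by (auto simp: bij_betw_inv_into_left)
    have "(\<Sum>k\<in>\<phi> ` F. (cmod (?d k))\<^sup>2) = (\<Sum>j\<in>F. (cmod (c j))\<^sup>2)"
      by (simp add: sum.reindex[OF inj] d)
    moreover have "(\<Sum>k\<in>\<phi> ` F. ?d k *\<^sub>C h k) = (\<Sum>j\<in>F. c j *\<^sub>C g j)"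
      unfolding sum.reindex[OF inj] using F by (intro sum.cong) (auto simp: d eq)
    moreover have "finite (\<phi> ` F)" "\<phi> ` F \<subseteq> K"
      using F bij_betw_imp_surj_on[OF bij] by auto
    ultimately show ?thesis
      using bound[of "\<phi> ` F" ?d] by simp
  qed
  then show ?thesis
    unfolding riesz_basis_def img using pos dense by blast
qed

text \<open>
  Asking for \<open>g = h \<circ> \<phi>\<close> on \<open>J\<close> only is what an orbit requires: its index set bounds the second
  component, and outside it the two families may differ.
\<close>

lemma riesz_basis_reindex:
  assumes bij: "bij_betw \<phi> J K" and eq: "\<And>j. j \<in> J \<Longrightarrow> g j = h (\<phi> j)"
  shows "riesz_basis J g \<longleftrightarrow> riesz_basis K h"
proof
  have "h k = g (inv_into J \<phi> k)" if "k \<in> K" for k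
    using that bij eq by (metis bij_betw_def bij_betw_inv_into_right inv_into_into)
  then show "riesz_basis J g \<Longrightarrow> riesz_basis K h"
    using bij by (blast intro: riesz_basis_reindex_imp bij_betw_inv_into)
qed (use assms in \<open>rule riesz_basis_reindex_imp\<close>)

text \<open>
  The operator \<open>V\<close> distorts the exact identity for the standard basis by at most its norm and that of
  its inverse, and it carries the expansions of vectors in the standard basis to expansions of
  arbitrary vectors of its target.
\<close>

lemma riesz_basis_image_ell2_basis:
  fixes V :: "ell2 \<Rightarrow> 'a::complex_hilbert"
  assumes "boundedly_invertible V"
  shows "riesz_basis UNIV (\<lambda>k. V (ell2_basis k))"
proof -
  have V: "bounded_clinear V" and bij: "bij V" and W: "bounded_clinear (inv V)"
    using assms by (auto simp: boundedly_invertible_def)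
  have bl: "bounded_linear V" "bounded_linear (inv V)"
    using V W by (auto simp: bounded_clinear_def)
  obtain K where K: "K > 0" "\<And>x. norm (V x) \<le> norm x * K"
    using bounded_linear.pos_bounded[OF bl(1)] by blast
  obtain L where L: "L > 0" "\<And>y. norm (inv V y) \<le> norm y * L"
    using bounded_linear.pos_bounded[OF bl(2)] by blast
  have upper: "(norm (V x))\<^sup>2 \<le> K\<^sup>2 * (norm x)\<^sup>2" for x
    using power_mono[OF K(2)[of x], of 2] by (simp add: power_mult_distrib mult.commute)
  have lower: "(1 / L\<^sup>2) * (norm x)\<^sup>2 \<le> (norm (V x))\<^sup>2" for x
  proof -
    have "norm x \<le> norm (V x) * L"
      using L(2)[of "V x"] bij by (simp add: bij_is_inj)
    from power_mono[OF this, of 2] show ?thesis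
      using L(1) by (simp add: power_mult_distrib field_simps)
  qed
  have "(1 / L\<^sup>2) * (\<Sum>j\<in>F. (cmod (c j))\<^sup>2) \<le> (norm (\<Sum>j\<in>F. c j *\<^sub>C V (ell2_basis j)))\<^sup>2 \<and>
        (norm (\<Sum>j\<in>F. c j *\<^sub>C V (ell2_basis j)))\<^sup>2 \<le> K\<^sup>2 * (\<Sum>j\<in>F. (cmod (c j))\<^sup>2)"
    if "finite F" for F c
    using lower[of "\<Sum>j\<in>F. c j *\<^sub>C ell2_basis j"] upper[of "\<Sum>j\<in>F. c j *\<^sub>C ell2_basis j"]
    by (simp only: norm_sum_ell2_basis[OF that] bounded_clinear_sum_scaleC[OF V] simp_thms)
  moreover have "closure (cspan (range (\<lambda>k. V (ell2_basis k)))) = UNIV"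
  proof (intro equalityI subsetI UNIV_I)
    fix y
    define x where "x = inv V y"
    have "(\<lambda>k. V (ell2_nth x k *\<^sub>C ell2_basis k)) sums V x"
      using bounded_linear.sums[OF bl(1) ell2_basis_expansion] .
    then have "(\<lambda>k. ell2_nth x k *\<^sub>C V (ell2_basis k)) sums y"
      using bij by (simp add: bounded_clinear_scaleC[OF V] x_def bij_is_surj surj_f_inv_f)
    then show "y \<in> closure (cspan (range (\<lambda>k. V (ell2_basis k))))"
      by (rule sums_in_closure_cspan)
  qed
  moreover have "1 / L\<^sup>2 > 0" "K\<^sup>2 > 0"
    using K(1) L(1) by auto
  ultimately show ?thesis
    unfolding riesz_basis_def by blast
qed

text \<open>
  A map that is bounded below reflects Cauchy sequences, so its range is complete, hence closed, and
  density makes it the whole space. The bound from below is also the bound of the inverse.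
\<close>

lemma bounded_below_dense_range_imp_boundedly_invertible:
  fixes V :: "'a::complex_hilbert \<Rightarrow> 'b::complex_hilbert"
  assumes V: "bounded_clinear V" and \<gamma>: "\<gamma> > 0" and below: "\<And>x. \<gamma> * norm x \<le> norm (V x)"
    and dense: "closure (range V) = UNIV"
  shows "boundedly_invertible V"
proof -
  have lin: "bounded_linear V"
    using V by (simp add: bounded_clinear_def)
  interpret V: bounded_linear V by (rule lin)
  have inj: "inj V"
    using below \<gamma> V.linear_axioms
    by (auto simp: linear_injective_0 mult_le_0_iff) (metis mult_le_0_iff norm_le_zero_iff norm_zero not_less)
  have "complete (range V)"
    using below by (intro complete_isometric_image[OF \<gamma> subspace_UNIV lin]) (auto simp: complete_UNIV)
  then have "closed (range V)"
    by (rule complete_imp_closed)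
  then have "surj V"
    using dense by (simp add: closure_closed)
  with inj have bij: "bij V" by (rule bijI)
  have VW: "V (inv V y) = y" for y
    using \<open>surj V\<close> by (rule surj_f_inv_f)
  have WV: "inv V y = x \<longleftrightarrow> y = V x" for x y
    using inj VW by (auto simp: inv_f_f)
  have "bounded_linear (inv V)"
  proof (rule bounded_linear_intro[where K = "1 / \<gamma>"])
    show "norm (inv V y) \<le> norm y * (1 / \<gamma>)" for y
      using below[of "inv V y"] \<gamma> by (simp add: VW field_simps)
  qed (simp_all add: WV VW V.add V.scaleR)
  moreover have "inv V (c *\<^sub>C y) = c *\<^sub>C inv V y" for c y
    by (simp add: WV VW bounded_clinear_scaleC[OF V])
  ultimately show ?thesis
    using V bij by (simp add: boundedly_invertible_def bounded_clinear_def)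
qed

text \<open>
  The operator is the synthesis operator of the family. Its bounds are the Riesz bounds on partial
  sums, passed to the limit.
\<close>

lemma riesz_basis_imp_image_ell2_basis:
  fixes h :: "nat \<Rightarrow> 'a::complex_hilbert"
  assumes "riesz_basis UNIV h"
  obtains V where "boundedly_invertible V" "\<And>k. V (ell2_basis k) = h k"
proof -
  obtain \<alpha> \<beta> where pos: "\<alpha> > 0" "\<beta> > 0" and dense: "closure (cspan (range h)) = UNIV"
    and bound: "\<And>F c. finite F \<Longrightarrow>
        \<alpha> * (\<Sum>j\<in>F. (cmod (c j))\<^sup>2) \<le> (norm (\<Sum>j\<in>F. c j *\<^sub>C h j))\<^sup>2 \<and>
        (norm (\<Sum>j\<in>F. c j *\<^sub>C h j))\<^sup>2 \<le> \<beta> * (\<Sum>j\<in>F. (cmod (c j))\<^sup>2)"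
    using assms unfolding riesz_basis_def by auto
  note lower = bound[THEN conjunct1] and upper = bound[THEN conjunct2]
  define V where "V x = (\<Sum>k. ell2_nth x k *\<^sub>C h k)" for x
  have summable: "summable (\<lambda>k. ell2_nth x k *\<^sub>C h k)" for x
    unfolding summable_Cauchy
  proof (intro allI impI)
    fix e :: real
    assume e: "e > 0"
    then have "e\<^sup>2 / \<beta> > 0" using pos by simp
    \<comment> \<open>By the upper bound, a block of the series has squared norm at most \<open>\<beta>\<close> times the
      corresponding block of the series of squared coefficients.\<close>
    then obtain N where N: "\<And>m n. m \<ge> N \<Longrightarrow> (\<Sum>k=m..<n. (cmod (ell2_nth x k))\<^sup>2) < e\<^sup>2 / \<beta>"
      using summable_ell2[of x] unfolding summable_Cauchy by (fastforce simp: sum_nonneg)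
    have "norm (\<Sum>k=m..<n. ell2_nth x k *\<^sub>C h k) < e" if "m \<ge> N" for m n
    proof -
      have "(norm (\<Sum>k=m..<n. ell2_nth x k *\<^sub>C h k))\<^sup>2 < e\<^sup>2"
        using upper[of "{m..<n}" "ell2_nth x"] N[OF that, of n] pos by (simp add: field_simps)
      then show ?thesis
        using e by (simp add: power_less_imp_less_base)
    qed
    then show "\<exists>N. \<forall>m\<ge>N. \<forall>n. norm (\<Sum>k=m..<n. ell2_nth x k *\<^sub>C h k) < e"
      by blast
  qed
  have sums: "(\<lambda>k. ell2_nth x k *\<^sub>C h k) sums V x" for x
    unfolding V_def by (rule summable_sums[OF summable])
  have lim: "(\<lambda>N. (norm (\<Sum>k<N. ell2_nth x k *\<^sub>C h k))\<^sup>2) \<longlonglongrightarrow> (norm (V x))\<^sup>2"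
    and lim_x: "(\<lambda>N. a * (\<Sum>k<N. (cmod (ell2_nth x k))\<^sup>2)) \<longlonglongrightarrow> a * (norm x)\<^sup>2" for x a
    using sums[of x] summable_LIMSEQ[OF summable_ell2[of x]]
    by (auto intro!: tendsto_intros simp: sums_def norm_ell2_squared)
  have lower_V: "\<alpha> * (norm x)\<^sup>2 \<le> (norm (V x))\<^sup>2" for x
    by (rule LIMSEQ_le[OF lim_x lim]) (auto intro: lower)
  have upper_V: "(norm (V x))\<^sup>2 \<le> \<beta> * (norm x)\<^sup>2" for x
    by (rule LIMSEQ_le[OF lim lim_x]) (auto intro: upper)
  have scale: "V (c *\<^sub>C x) = c *\<^sub>C V x" for c x
    using bounded_linear.sums[OF bounded_linear_scaleC sums, of c x]
    by (simp add: V_def scaleC_scaleC sums_iff)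
  have add: "V (x + y) = V x + V y" for x y
    using sums_add[OF sums sums, of x y] by (simp add: V_def scaleC_add_left sums_iff)
  have V: "bounded_clinear V"
    unfolding bounded_clinear_def
  proof (intro conjI allI add scale bounded_linear_intro[where K = "sqrt \<beta>"])
    show "V (r *\<^sub>R x) = r *\<^sub>R V x" for r x
      by (simp add: scaleR_scaleC scale)
    show "norm (V x) \<le> norm x * sqrt \<beta>" for x
      using real_sqrt_le_mono[OF upper_V[of x]] by (simp add: real_sqrt_mult mult.commute)
  qed
  have V_basis: "V (ell2_basis k) = h k" for k
  proof -
    have "(\<Sum>j. ell2_nth (ell2_basis k) j *\<^sub>C h j) = (\<Sum>j\<in>{k}. ell2_nth (ell2_basis k) j *\<^sub>C h j)"
      by (rule suminf_finite) (auto simp: ell2_basis.rep_eq)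
    then show ?thesis
      by (simp add: V_def ell2_basis.rep_eq scaleC_one)
  qed
  have "boundedly_invertible V"
  proof (rule bounded_below_dense_range_imp_boundedly_invertible[OF V])
    show "sqrt \<alpha> > 0" using pos by simp
    show "sqrt \<alpha> * norm x \<le> norm (V x)" for x
      using real_sqrt_le_mono[OF lower_V[of x]] by (simp add: real_sqrt_mult)
    have "complex_vector.subspace (range V)"
    proof (rule complex_vector.subspaceI)
      show "0 \<in> range V"
        using scale[of 0 0] by (metis complex_vector.scale_zero_left rangeI)
      show "y + z \<in> range V" if "y \<in> range V" "z \<in> range V" for y z
        using that by (auto simp flip: add)
      show "c *\<^sub>C y \<in> range V" if "y \<in> range V" for c y
        using that by (auto simp flip: scale)
    qed
    moreover have "range h \<subseteq> range V"
      by (auto simp flip: V_basis)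
    ultimately have "cspan (range h) \<subseteq> range V"
      by (intro complex_vector.span_minimal)
    then show "closure (range V) = UNIV"
      using dense closure_mono by blast
  qed
  then show ?thesis
    using V_basis that by blast
qed

lemma riesz_basis_iff_image_ell2_basis:
  fixes h :: "nat \<Rightarrow> 'a::complex_hilbert"
  shows "riesz_basis UNIV h \<longleftrightarrow> (\<exists>V. boundedly_invertible V \<and> (\<forall>k. h k = V (ell2_basis k)))"
proof
  show "riesz_basis UNIV h" if "\<exists>V. boundedly_invertible V \<and> (\<forall>k. h k = V (ell2_basis k))"
    using that riesz_basis_image_ell2_basis by (metis ext)
qed (metis riesz_basis_imp_image_ell2_basis)

section \<open>Orbits\<close>

lemma bij_betw_division_with_remainder:
  assumes "(m :: nat) \<noteq> 0"
  shows "bij_betw (\<lambda>(n, i). m * n + i) (UNIV \<times> {0..<m}) UNIV"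
  by (rule bij_betw_byWitness[where f' = "\<lambda>k. (k div m, k mod m)"]) (use assms in auto)

text \<open>
  Conjugation by \<open>V\<close> is tested on the standard basis, where it reads
  \<open>A (V (ell2_basis k)) = V (ell2_basis (m + k))\<close>. Together with the values on the first \<open>m\<close> basis
  vectors this recursion determines \<open>V (ell2_basis k)\<close> for all \<open>k\<close>, by division with remainder.
\<close>

lemma orbit_eq_image_ell2_basis_iff:
  fixes A :: "'a::complex_hilbert \<Rightarrow> 'a"
  assumes "m \<noteq> 0" "bounded_clinear A" "boundedly_invertible V"
  shows "(\<forall>k. (A ^^ (k div m)) (f (k mod m)) = V (ell2_basis k)) \<longleftrightarrow>
    A = V \<circ> (right_shift ^^ m) \<circ> inv V \<and> (\<forall>i\<in>{0..<m}. f i = V (ell2_basis i))"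
    (is "?orbit \<longleftrightarrow> ?conj \<and> ?start")
proof -
  have V: "bounded_clinear V" and bij: "bij V"
    using assms(3) by (auto simp: boundedly_invertible_def)
  have conj_iff: "?conj \<longleftrightarrow> A \<circ> V = V \<circ> (right_shift ^^ m)"
    using bij by (auto simp: fun_eq_iff bij_is_inj) (metis bij bij_is_surj surj_f_inv_f)
  have intertwine_iff:
    "A \<circ> V = V \<circ> (right_shift ^^ m) \<longleftrightarrow> (\<forall>k. A (V (ell2_basis k)) = V (ell2_basis (m + k)))"
  proof
    assume "\<forall>k. A (V (ell2_basis k)) = V (ell2_basis (m + k))"
    then show "A \<circ> V = V \<circ> (right_shift ^^ m)"
      using assms V by (intro bounded_clinear_eqI_ell2_basis bounded_clinear_compose
          bounded_clinear_funpow bounded_clinear_right_shift) (auto simp: right_shift_funpow_basis)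
  qed (metis comp_apply right_shift_funpow_basis)
  have "?orbit \<longleftrightarrow> (\<forall>k. A (V (ell2_basis k)) = V (ell2_basis (m + k))) \<and> ?start"
  proof (intro iffI conjI allI ballI; (elim conjE)?)
    fix k
    assume orbit: ?orbit
    have "A (V (ell2_basis k)) = (A ^^ ((m + k) div m)) (f ((m + k) mod m))"
      using assms(1) orbit by (simp flip: orbit[rule_format])
    also have "\<dots> = V (ell2_basis (m + k))"
      by (rule orbit[rule_format])
    finally show "A (V (ell2_basis k)) = V (ell2_basis (m + k))" .
  next
    fix i
    assume ?orbit "i \<in> {0..<m}"
    then show "f i = V (ell2_basis i)"
      by (auto dest: spec[of _ i])
  next
    fix k
    assume step: "\<forall>k. A (V (ell2_basis k)) = V (ell2_basis (m + k))" and start: ?start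
    have "(A ^^ n) (V (ell2_basis i)) = V (ell2_basis (m * n + i))" for n i
      by (induction n) (auto simp: step add.assoc)
    then show "(A ^^ (k div m)) (f (k mod m)) = V (ell2_basis k)"
      using assms(1) start by simp
  qed
  then show ?thesis
    by (simp add: conj_iff intertwine_iff)
qed

theorem theorem3p12:
  fixes A :: "'a::complex_hilbert \<Rightarrow> 'a" and m :: nat and f :: "nat \<Rightarrow> 'a"
  assumes "separable_space (euclidean :: 'a topology)"
    and "m \<noteq> 0"
    and "bounded_clinear A"
  shows "riesz_basis (UNIV \<times> {0..<m}) (\<lambda>(n, i). (A ^^ n) (f i)) \<longleftrightarrow>
    (\<exists>V :: ell2 \<Rightarrow> 'a. boundedly_invertible V \<and>
       A = V \<circ> (right_shift ^^ m) \<circ> inv V \<and>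
       (\<forall>i\<in>{0..<m}. f i = V (ell2_basis i)))"
proof -
  have "riesz_basis (UNIV \<times> {0..<m}) (\<lambda>(n, i). (A ^^ n) (f i)) \<longleftrightarrow>
      riesz_basis UNIV (\<lambda>k. (A ^^ (k div m)) (f (k mod m)))"
    by (rule riesz_basis_reindex[OF bij_betw_division_with_remainder[OF assms(2)]]) auto
  also have "\<dots> \<longleftrightarrow> (\<exists>V. boundedly_invertible V \<and>
      (\<forall>k. (A ^^ (k div m)) (f (k mod m)) = V (ell2_basis k)))"
    by (rule riesz_basis_iff_image_ell2_basis)
  finally show ?thesis
    using orbit_eq_image_ell2_basis_iff[OF assms(2,3)] by blast
qed

end
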